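(* Let $n\ge 2$ and let $X$ be either the cyclic group heap $\mathbb{Z}_n$ or the dihedral group heap $D_n$ (the dihedral group of order $2n$). Then $${\rm rank}\,H^2_{\rm NDH}(X,\mathbb{Z})\ \ge\ n-1 .$$
   Context: A group heap is a group $X$ with the ternary operation $[x,y,z]=xy^{-1}z$. For $m\ge1$, $C_m^{\rm SD}(X)$ is the free abelian group generated by $(2m-1)$-tuples $(x_1,\dots,x_{2m-1})$ of elements of $X$, with boundary (and $d_1=0$) $$d_m(x_1,\dots,x_{2m-1})=\sum_{i=1}^{m-1}(-1)^i\big[(x_1,\dots,\widehat{x_{2i},x_{2i+1}},\dots,x_{2m-1})-(x_1x_{2i}^{-1}x_{2i+1},\dots,x_{2i-1}x_{2i}^{-1}x_{2i+1},\widehat{x_{2i},x_{2i+1}},x_{2i+2},\dots,x_{2m-1})\big],$$ where hats denote omission. The nondegenerate subcomplex $C_m^{\rm NDH}(X)$ is the subcomplex generated by the tuples with $x_{2i}\neq x_{2i+1}$ for all $i\in\{1,\dots,m-1\}$. Nondegenerate cohomology $H^m_{\rm NDH}(X,A)$ is the cohomology of ${\rm Hom}(C_\bullet^{\rm NDH}(X),A)$ with differential $\delta^m$ dual to $d_{m+1}$. *)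

theory Defs
  imports "HOL-Algebra.Algebra" "HOL-Library.Extended_Nat"
begin

definition heap_op :: "('a, 'b) monoid_scheme \<Rightarrow> 'a \<Rightarrow> 'a \<Rightarrow> 'a \<Rightarrow> 'a" where
  "heap_op G x y z = x \<otimes>\<^bsub>G\<^esub> inv\<^bsub>G\<^esub> y \<otimes>\<^bsub>G\<^esub> z"

(* The pair (a, b) stands for r^a s^b, where r is the rotation of order n, s is a reflection
   and s r s = r^(-1). *)
definition dihedral_group :: "nat \<Rightarrow> (int \<times> bool) monoid" where
  "dihedral_group n =
     \<lparr>carrier = {0..<int n} \<times> UNIV,
      monoid.mult = (\<lambda>(a, b) (c, d). ((if b then a - c else a + c) mod int n, b \<noteq> d)),
      one = (0, False)\<rparr>"

lemma group_dihedral_group: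
  assumes "n \<ge> 1"
  shows "group (dihedral_group n)"
proof (rule groupI)
  fix x y z
  assume "x \<in> carrier (dihedral_group n)" "y \<in> carrier (dihedral_group n)"
    "z \<in> carrier (dihedral_group n)"
  then show "x \<otimes>\<^bsub>dihedral_group n\<^esub> y \<otimes>\<^bsub>dihedral_group n\<^esub> z =
             x \<otimes>\<^bsub>dihedral_group n\<^esub> (y \<otimes>\<^bsub>dihedral_group n\<^esub> z)"
    by (auto simp: dihedral_group_def mod_simps algebra_simps split: prod.splits)
next
  fix x assume x: "x \<in> carrier (dihedral_group n)"
  then obtain a b where ab: "x = (a, b)" by (cases x)
  define y where "y = (if b then x else ((- a) mod int n, False))"
  have "y \<in> carrier (dihedral_group n)" "y \<otimes>\<^bsub>dihedral_group n\<^esub> x = \<one>\<^bsub>dihedral_group n\<^esub>"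
    using x assms ab by (auto simp: y_def dihedral_group_def mod_simps)
  then show "\<exists>y\<in>carrier (dihedral_group n). y \<otimes>\<^bsub>dihedral_group n\<^esub> x = \<one>\<^bsub>dihedral_group n\<^esub>"
    by blast
qed (use assms in \<open>auto simp: dihedral_group_def split: prod.splits\<close>)

lemma order_dihedral_group: "order (dihedral_group n) = 2 * n"
  by (simp add: order_def dihedral_group_def card_cartesian_product)

(* A tuple (x_1, ..., x_{2m-1}) is the list whose entry number j - 1 is x_j.
   For m = 0 there are no tuples. *)
definition sd_tuples :: "('a, 'b) monoid_scheme \<Rightarrow> nat \<Rightarrow> 'a list set" where
  "sd_tuples G m = {xs. length xs + 1 = 2 * m \<and> set xs \<subseteq> carrier G}"

definition ndh_tuples :: "('a, 'b) monoid_scheme \<Rightarrow> nat \<Rightarrow> 'a list set" where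
  "ndh_tuples G m = {xs \<in> sd_tuples G m. \<forall>i\<in>{1..m - 1}. xs ! (2 * i - 1) \<noteq> xs ! (2 * i)}"

definition sd_chain_group :: "('a, 'b) monoid_scheme \<Rightarrow> nat \<Rightarrow> ('a list \<Rightarrow>\<^sub>0 int) monoid" where
  "sd_chain_group G m = free_Abelian_group (sd_tuples G m)"

definition ndh_chain_group :: "('a, 'b) monoid_scheme \<Rightarrow> nat \<Rightarrow> ('a list \<Rightarrow>\<^sub>0 int) monoid" where
  "ndh_chain_group G m = subgroup_generated (sd_chain_group G m) (frag_of ` ndh_tuples G m)"

lemma ndh_chain_group_eq: "ndh_chain_group G m = free_Abelian_group (ndh_tuples G m)"
proof -
  let ?F = "sd_chain_group G m"
  let ?H = "{c :: 'a list \<Rightarrow>\<^sub>0 int. Poly_Mapping.keys c \<subseteq> ndh_tuples G m}"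
  interpret F: group ?F by (simp add: sd_chain_group_def)
  have sub: "ndh_tuples G m \<subseteq> sd_tuples G m"
    by (auto simp: ndh_tuples_def)
  have gens: "frag_of ` ndh_tuples G m \<subseteq> carrier ?F"
    using sub by (auto simp: sd_chain_group_def free_Abelian_group_def)
  have inv: "inv\<^bsub>?F\<^esub> c = - c" if "c \<in> carrier ?F" for c
    using that by (simp add: sd_chain_group_def)
  have diff: "a - b \<in> generate ?F (frag_of ` ndh_tuples G m)"
    if "a \<in> generate ?F (frag_of ` ndh_tuples G m)" "b \<in> generate ?F (frag_of ` ndh_tuples G m)" for a b
  proof -
    have "a \<otimes>\<^bsub>?F\<^esub> inv\<^bsub>?F\<^esub> b \<in> generate ?F (frag_of ` ndh_tuples G m)"
      using that F.generate_m_inv_closed[OF gens] by (blast intro: generate.eng)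
    moreover have "b \<in> carrier ?F" using F.generate_in_carrier[OF gens that(2)] .
    ultimately show ?thesis by (simp add: inv) (simp add: sd_chain_group_def free_Abelian_group_def)
  qed
  have "generate ?F (frag_of ` ndh_tuples G m) = ?H"
  proof
    show "generate ?F (frag_of ` ndh_tuples G m) \<subseteq> ?H"
    proof (rule F.generate_subgroup_incl)
      show "subgroup ?H ?F"
      proof (rule F.subgroupI)
        show "inv\<^bsub>?F\<^esub> c \<in> ?H" if "c \<in> ?H" for c
          using that sub by (subst inv) (auto simp: sd_chain_group_def free_Abelian_group_def)
        show "c \<otimes>\<^bsub>?F\<^esub> d \<in> ?H" if "c \<in> ?H" "d \<in> ?H" for c d
          using that keys_add[of c d] by (auto simp: sd_chain_group_def free_Abelian_group_def)
        show "?H \<subseteq> carrier ?F" using sub by (auto simp: sd_chain_group_def free_Abelian_group_def)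
        show "?H \<noteq> {}" by (auto intro: exI[of _ 0])
      qed
    qed auto
    show "?H \<subseteq> generate ?F (frag_of ` ndh_tuples G m)"
    proof
      fix c assume "c \<in> ?H"
      then have "Poly_Mapping.keys c \<subseteq> ndh_tuples G m" by simp
      then show "c \<in> generate ?F (frag_of ` ndh_tuples G m)"
      proof (induction c rule: frag_induction)
        case zero
        then show ?case
          using generate.one[of ?F] by (simp add: sd_chain_group_def free_Abelian_group_def)
      qed (auto intro: generate.incl diff)
    qed
  qed
  then show ?thesis
    using gens by (simp add: ndh_chain_group_def subgroup_generated_def Int_absorb1
        sd_chain_group_def free_Abelian_group_def)
qed

definition sd_face_omit :: "nat \<Rightarrow> 'a list \<Rightarrow> 'a list" where
  "sd_face_omit i xs = take (2 * i - 1) xs @ drop (2 * i + 1) xs"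

definition sd_face_act :: "('a, 'b) monoid_scheme \<Rightarrow> nat \<Rightarrow> 'a list \<Rightarrow> 'a list" where
  "sd_face_act G i xs =
     map (\<lambda>y. heap_op G y (xs ! (2 * i - 1)) (xs ! (2 * i))) (take (2 * i - 1) xs)
     @ drop (2 * i + 1) xs"

definition sd_boundary ::
  "('a, 'b) monoid_scheme \<Rightarrow> nat \<Rightarrow> ('a list \<Rightarrow>\<^sub>0 int) \<Rightarrow> ('a list \<Rightarrow>\<^sub>0 int)" where
  "sd_boundary G m =
     frag_extend (\<lambda>xs. \<Sum>i=1..m - 1.
       frag_cmul ((-1) ^ i) (frag_of (sd_face_omit i xs) - frag_of (sd_face_act G i xs)))"

definition hom_group ::
  "('a, 'b) monoid_scheme \<Rightarrow> ('c, 'd) monoid_scheme \<Rightarrow> ('a \<Rightarrow> 'c) monoid" where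
  "hom_group C A =
     \<lparr>carrier = hom C A \<inter> extensional (carrier C),
      monoid.mult = (\<lambda>f g. \<lambda>x\<in>carrier C. f x \<otimes>\<^bsub>A\<^esub> g x),
      one = (\<lambda>x\<in>carrier C. \<one>\<^bsub>A\<^esub>)\<rparr>"

definition ndh_cochain_group ::
  "('a, 'b) monoid_scheme \<Rightarrow> ('c, 'd) monoid_scheme \<Rightarrow> nat \<Rightarrow> (('a list \<Rightarrow>\<^sub>0 int) \<Rightarrow> 'c) monoid" where
  "ndh_cochain_group G A m = hom_group (ndh_chain_group G m) A"

definition ndh_coboundary ::
  "('a, 'b) monoid_scheme \<Rightarrow> nat \<Rightarrow> (('a list \<Rightarrow>\<^sub>0 int) \<Rightarrow> 'c) \<Rightarrow> (('a list \<Rightarrow>\<^sub>0 int) \<Rightarrow> 'c)" where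
  "ndh_coboundary G m f = (\<lambda>c\<in>carrier (ndh_chain_group G (m + 1)). f (sd_boundary G (m + 1) c))"

(* Meant for m >= 1. For m = 1 the chain group of index m - 1 = 0 is trivial, so nothing but
   the zero cochain is divided out. *)
definition ndh_cohomology_group ::
  "('a, 'b) monoid_scheme \<Rightarrow> ('c, 'd) monoid_scheme \<Rightarrow> nat
     \<Rightarrow> (('a list \<Rightarrow>\<^sub>0 int) \<Rightarrow> 'c) set monoid" where
  "ndh_cohomology_group G A m =
     (ndh_cochain_group G A m)
       \<lparr>carrier := kernel (ndh_cochain_group G A m) (ndh_cochain_group G A (m + 1))
                          (ndh_coboundary G m)\<rparr>
     Mod (ndh_coboundary G (m - 1) ` carrier (ndh_cochain_group G A (m - 1)))"

definition int_independent :: "('a, 'b) monoid_scheme \<Rightarrow> 'a set \<Rightarrow> bool" where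
  "int_independent G S \<longleftrightarrow>
     finite S \<and> S \<subseteq> carrier G \<and>
     (\<forall>k :: 'a \<Rightarrow> int. (\<Otimes>\<^bsub>G\<^esub>x\<in>S. x [^]\<^bsub>G\<^esub> k x) = \<one>\<^bsub>G\<^esub> \<longrightarrow> (\<forall>x\<in>S. k x = 0))"

(* The rank of an abelian group G, i.e. the dimension of the rational vector space obtained by
   tensoring G with the rationals; all infinite ranks are identified. *)
definition abelian_rank :: "('a, 'b) monoid_scheme \<Rightarrow> enat" where
  "abelian_rank G = Sup {enat (card S) | S. int_independent G S}"

lemma sd_face_omit_ndh:
  assumes "xs \<in> ndh_tuples G m" "i \<in> {1..m - 1}"
  shows "sd_face_omit i xs \<in> ndh_tuples G (m - 1)"
proof -
  have len: "length xs + 1 = 2 * m" and sub: "set xs \<subseteq> carrier G"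
    and nd: "\<And>j. j \<in> {1..m - 1} \<Longrightarrow> xs ! (2 * j - 1) \<noteq> xs ! (2 * j)"
    using assms(1) by (auto simp: ndh_tuples_def sd_tuples_def)
  have nth: "sd_face_omit i xs ! j = (if j < 2 * i - 1 then xs ! j else xs ! (j + 2))"
    if "j < 2 * m - 3" for j
    using that len assms(2) by (auto simp: sd_face_omit_def nth_append min_def)
  have "sd_face_omit i xs ! (2 * j - 1) \<noteq> sd_face_omit i xs ! (2 * j)"
    if j: "j \<in> {1..m - 1 - 1}" for j
  proof (cases "j < i")
    case True
    then have "2 * j - 1 < 2 * m - 3" "2 * j < 2 * m - 3" "2 * j - 1 < 2 * i - 1" "2 * j < 2 * i - 1"
      "j \<in> {1..m - 1}" using j by auto
    then show ?thesis using nth[of "2 * j - 1"] nth[of "2 * j"] nd[of j] by simp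
  next
    case False
    have "2 * j - 1 + 2 = 2 * (j + 1) - 1" "2 * j + 2 = 2 * (j + 1)" using j by auto
    then show ?thesis
      using False nth[of "2 * j - 1"] nth[of "2 * j"] j nd[of "j + 1"] by auto
  qed
  moreover have "set (sd_face_omit i xs) \<subseteq> carrier G"
    using sub by (auto simp: sd_face_omit_def dest: in_set_takeD in_set_dropD)
  moreover have "length (sd_face_omit i xs) + 1 = 2 * (m - 1)"
    using len assms(2) by (auto simp: sd_face_omit_def)
  ultimately show ?thesis by (auto simp: ndh_tuples_def sd_tuples_def)
qed

lemma sd_face_act_ndh:
  assumes "group G" "xs \<in> ndh_tuples G m" "i \<in> {1..m - 1}"
  shows "sd_face_act G i xs \<in> ndh_tuples G (m - 1)"
proof -
  interpret group G by fact
  have len: "length xs + 1 = 2 * m" and sub: "set xs \<subseteq> carrier G"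
    and nd: "\<And>j. j \<in> {1..m - 1} \<Longrightarrow> xs ! (2 * j - 1) \<noteq> xs ! (2 * j)"
    using assms(2) by (auto simp: ndh_tuples_def sd_tuples_def)
  define h where "h = (\<lambda>y. heap_op G y (xs ! (2 * i - 1)) (xs ! (2 * i)))"
  have el: "xs ! j \<in> carrier G" if "j < 2 * m - 1" for j
    using that len sub by (auto intro!: subsetD[OF sub] nth_mem)
  have uv: "xs ! (2 * i - 1) \<in> carrier G" "xs ! (2 * i) \<in> carrier G"
    using assms(3) by (auto intro!: el)
  have h_closed: "h y \<in> carrier G" if "y \<in> carrier G" for y
    using that uv by (simp add: h_def heap_op_def)
  have h_inj: "h y = h z \<longleftrightarrow> y = z" if "y \<in> carrier G" "z \<in> carrier G" for y z
    using that uv by (simp add: h_def heap_op_def)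
  have nth: "sd_face_act G i xs ! j = (if j < 2 * i - 1 then h (xs ! j) else xs ! (j + 2))"
    if "j < 2 * m - 3" for j
    using that len assms(3) by (auto simp: sd_face_act_def h_def nth_append min_def)
  have "sd_face_act G i xs ! (2 * j - 1) \<noteq> sd_face_act G i xs ! (2 * j)"
    if j: "j \<in> {1..m - 1 - 1}" for j
  proof (cases "j < i")
    case True
    have "xs ! (2 * j - 1) \<in> carrier G" "xs ! (2 * j) \<in> carrier G"
      using j by (auto intro!: el)
    moreover have "2 * j - 1 < 2 * m - 3" "2 * j < 2 * m - 3" "2 * j - 1 < 2 * i - 1"
      "2 * j < 2 * i - 1" "j \<in> {1..m - 1}" using True j by auto
    ultimately show ?thesis using nth[of "2 * j - 1"] nth[of "2 * j"] nd[of j] h_inj by simp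
  next
    case False
    have "2 * j - 1 + 2 = 2 * (j + 1) - 1" "2 * j + 2 = 2 * (j + 1)" using j by auto
    then show ?thesis
      using False nth[of "2 * j - 1"] nth[of "2 * j"] j nd[of "j + 1"] by auto
  qed
  moreover have "set (sd_face_act G i xs) \<subseteq> carrier G"
    using sub h_closed unfolding sd_face_act_def h_def[symmetric]
    by (auto dest!: in_set_takeD dest: in_set_dropD)
  moreover have "length (sd_face_act G i xs) + 1 = 2 * (m - 1)"
    using len assms(3) by (auto simp: sd_face_act_def)
  ultimately show ?thesis by (auto simp: ndh_tuples_def sd_tuples_def)
qed

lemma sd_boundary_ndh_hom:
  assumes "group G"
  shows "sd_boundary G m \<in> hom (ndh_chain_group G m) (ndh_chain_group G (m - 1))"
proof (rule homI)
  fix c assume "c \<in> carrier (ndh_chain_group G m)"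
  then have c: "Poly_Mapping.keys c \<subseteq> ndh_tuples G m"
    by (simp add: ndh_chain_group_eq free_Abelian_group_def)
  have "Poly_Mapping.keys
      (\<Sum>i=1..m - 1. frag_cmul ((-1) ^ i) (frag_of (sd_face_omit i xs) - frag_of (sd_face_act G i xs)))
      \<subseteq> ndh_tuples G (m - 1)" if xs: "xs \<in> ndh_tuples G m" for xs
  proof (rule order_trans[OF keys_sum], rule UN_least)
    fix i assume i: "i \<in> {1..m - 1}"
    have "Poly_Mapping.keys (frag_of (sd_face_omit i xs) - frag_of (sd_face_act G i xs))
        \<subseteq> {sd_face_omit i xs, sd_face_act G i xs}"
      by (rule order_trans[OF keys_diff]) auto
    then show "Poly_Mapping.keys
        (frag_cmul ((-1) ^ i) (frag_of (sd_face_omit i xs) - frag_of (sd_face_act G i xs)))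
        \<subseteq> ndh_tuples G (m - 1)"
      using sd_face_omit_ndh[OF xs i] sd_face_act_ndh[OF assms xs i] keys_cmul by fastforce
  qed
  then have "Poly_Mapping.keys (sd_boundary G m c) \<subseteq> ndh_tuples G (m - 1)"
    unfolding sd_boundary_def using c by (intro order_trans[OF keys_frag_extend] UN_least) blast
  then show "sd_boundary G m c \<in> carrier (ndh_chain_group G (m - 1))"
    by (simp add: ndh_chain_group_eq free_Abelian_group_def)
qed (simp add: ndh_chain_group_eq free_Abelian_group_def sd_boundary_def frag_extend_add)

end

theory Submission
  imports Defs
begin

text \<open>For a nontrivial element \<open>t\<close> of a finite group \<open>G\<close>, the indicator function of \<open>a b\<^sup>-\<^sup>1 = t\<close> is a
  2-cochain on triples \<open>(x, a, b)\<close> that does not depend on \<open>x\<close> and is invariant under right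
  translation of \<open>(a, b)\<close>; these two properties make it a cocycle. The chain
  \<open>\<Sum>x\<in>G. (x, s, 1)\<close> is a 2-cycle because \<open>x \<mapsto> x s\<^sup>-\<^sup>1\<close> permutes \<open>G\<close>, so evaluation at it is a
  homomorphism on cohomology. It sends the cocycle of \<open>t\<close> to \<open>|G|\<close> if \<open>s = t\<close> and to \<open>0\<close> otherwise,
  so the cocycles represent \<open>|G| - 1\<close> independent classes.\<close>

section \<open>Independence by duality\<close>

lemma hom_integer_finprod_int_pow:
  fixes k :: "'a \<Rightarrow> int"
  assumes "comm_group K" "\<chi> \<in> hom K integer_group" "finite S" "S \<subseteq> carrier K"
  shows "\<chi> (\<Otimes>\<^bsub>K\<^esub>x\<in>S. x [^]\<^bsub>K\<^esub> k x) = (\<Sum>x\<in>S. k x * \<chi> x)"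
proof -
  interpret K: comm_group K by fact
  interpret \<chi>: group_hom K integer_group \<chi>
    using assms(2) by (simp add: group_hom_def group_hom_axioms_def)
  from assms(3,4) show ?thesis
  proof (induction S rule: finite_induct)
    case empty
    show ?case using \<chi>.hom_one by simp
  next
    case (insert y S)
    have "\<chi> (\<Otimes>\<^bsub>K\<^esub>x\<in>insert y S. x [^]\<^bsub>K\<^esub> k x)
        = \<chi> (y [^]\<^bsub>K\<^esub> k y \<otimes>\<^bsub>K\<^esub> (\<Otimes>\<^bsub>K\<^esub>x\<in>S. x [^]\<^bsub>K\<^esub> k x))"
      using insert by (subst K.finprod_insert) auto
    also have "\<dots> = \<chi> (y [^]\<^bsub>K\<^esub> k y) + \<chi> (\<Otimes>\<^bsub>K\<^esub>x\<in>S. x [^]\<^bsub>K\<^esub> k x)"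
      using insert by (subst \<chi>.hom_mult) (auto intro!: K.finprod_closed)
    also have "\<chi> (y [^]\<^bsub>K\<^esub> k y) = k y * \<chi> y"
      using insert by (simp add: \<chi>.hom_int_pow)
    finally show ?case using insert by simp
  qed
qed

text \<open>A relation among the \<open>x t\<close>, fed to \<open>\<chi> s\<close>, loses every
  term except \<open>k (x s) * \<chi> s (x s)\<close>, whose second factor is a nonzero integer.
  Hence all coefficients vanish.\<close>

lemma abelian_rank_ge_card_dual_family:
  fixes \<chi> :: "'i \<Rightarrow> 'a \<Rightarrow> int"
  assumes "comm_group K" "finite T" "\<And>t. t \<in> T \<Longrightarrow> x t \<in> carrier K"
    and hom: "\<And>s. s \<in> T \<Longrightarrow> \<chi> s \<in> hom K integer_group"
    and dual: "\<And>s t. s \<in> T \<Longrightarrow> t \<in> T \<Longrightarrow> \<chi> s (x t) = 0 \<longleftrightarrow> s \<noteq> t"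
  shows "enat (card T) \<le> abelian_rank K"
proof -
  \<comment> \<open>A collision \<open>x s = x t\<close> with \<open>s \<noteq> t\<close> would make
    \<open>\<chi> s (x s)\<close> both nonzero and zero.\<close>
  have inj: "inj_on x T"
    using dual by (metis inj_onI)
  have "int_independent K (x ` T)"
    unfolding int_independent_def
  proof (intro conjI allI impI ballI)
    fix k :: "'a \<Rightarrow> int" and y
    assume rel: "(\<Otimes>\<^bsub>K\<^esub>y\<in>x ` T. y [^]\<^bsub>K\<^esub> k y) = \<one>\<^bsub>K\<^esub>" and "y \<in> x ` T"
    then obtain s where s: "s \<in> T" "y = x s" by blast
    interpret \<chi>: group_hom K integer_group "\<chi> s"
      using assms(1) hom[OF s(1)]
      by (simp add: group_hom_def group_hom_axioms_def comm_group.axioms(2))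
    have "0 = \<chi> s (\<Otimes>\<^bsub>K\<^esub>y\<in>x ` T. y [^]\<^bsub>K\<^esub> k y)"
      using rel \<chi>.hom_one by simp
    also have "\<dots> = (\<Sum>y\<in>x ` T. k y * \<chi> s y)"
      using assms by (intro hom_integer_finprod_int_pow[OF assms(1) hom[OF s(1)]]) auto
    also have "\<dots> = (\<Sum>t\<in>T. k (x t) * \<chi> s (x t))"
      using inj by (simp add: sum.reindex)
    also have "\<dots> = (\<Sum>t\<in>T. if t = s then k (x s) * \<chi> s (x s) else 0)"
      using dual s(1) by (intro sum.cong) auto
    also have "\<dots> = k (x s) * \<chi> s (x s)"
      using s(1) assms(2) by simp
    finally show "k y = 0"
      using dual[OF s(1) s(1)] s(2) by simp
  qed (use assms in auto)
  moreover have "card (x ` T) = card T"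
    using inj by (rule card_image)
  ultimately show ?thesis
    unfolding abelian_rank_def by (intro Sup_upper) (metis (mono_tags, lifting) mem_Collect_eq)
qed

section \<open>Nondegenerate cochains\<close>

lemma comm_group_hom_group:
  assumes "group C" "comm_group A"
  shows "comm_group (hom_group C A)"
proof -
  interpret C: group C by fact
  interpret A: comm_group A by fact
  have closed: "f x \<in> carrier A" if "f \<in> hom C A" "x \<in> carrier C" for f x
    using that by (auto simp: hom_def)
  have mult: "f (x \<otimes>\<^bsub>C\<^esub> y) = f x \<otimes>\<^bsub>A\<^esub> f y"
    if "f \<in> hom C A" "x \<in> carrier C" "y \<in> carrier C" for f x y
    using that by (auto simp: hom_def)
  show ?thesis
  proof (rule comm_groupI)
    fix f g assume "f \<in> carrier (hom_group C A)" "g \<in> carrier (hom_group C A)"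
    then show "f \<otimes>\<^bsub>hom_group C A\<^esub> g \<in> carrier (hom_group C A)"
      by (auto simp: hom_group_def closed mult A.m_ac intro!: homI)
    from \<open>f \<in> _\<close> \<open>g \<in> _\<close>
    show "f \<otimes>\<^bsub>hom_group C A\<^esub> g = g \<otimes>\<^bsub>hom_group C A\<^esub> f"
      by (auto simp: hom_group_def fun_eq_iff closed A.m_ac)
  next
    show "\<one>\<^bsub>hom_group C A\<^esub> \<in> carrier (hom_group C A)"
      by (auto simp: hom_group_def intro!: homI)
  next
    fix f g h assume "f \<in> carrier (hom_group C A)" "g \<in> carrier (hom_group C A)"
      "h \<in> carrier (hom_group C A)"
    then show "f \<otimes>\<^bsub>hom_group C A\<^esub> g \<otimes>\<^bsub>hom_group C A\<^esub> h
             = f \<otimes>\<^bsub>hom_group C A\<^esub> (g \<otimes>\<^bsub>hom_group C A\<^esub> h)"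
      by (auto simp: hom_group_def fun_eq_iff closed A.m_ac)
  next
    fix f assume "f \<in> carrier (hom_group C A)"
    then have f: "f \<in> hom C A" "f \<in> extensional (carrier C)"
      by (auto simp: hom_group_def)
    \<comment> \<open>Off the carrier both sides are \<open>undefined\<close>; this is where
      extensionality of \<open>f\<close> enters.\<close>
    then show "\<one>\<^bsub>hom_group C A\<^esub> \<otimes>\<^bsub>hom_group C A\<^esub> f = f"
      by (auto simp: hom_group_def fun_eq_iff closed extensional_def)
    define g where "g = (\<lambda>x\<in>carrier C. inv\<^bsub>A\<^esub> f x)"
    have "g \<in> carrier (hom_group C A)"
      using f by (auto simp: g_def hom_group_def closed mult A.inv_mult intro!: homI)
    moreover have "g \<otimes>\<^bsub>hom_group C A\<^esub> f = \<one>\<^bsub>hom_group C A\<^esub>"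
      using f by (auto simp: g_def hom_group_def fun_eq_iff closed)
    ultimately show "\<exists>g\<in>carrier (hom_group C A). g \<otimes>\<^bsub>hom_group C A\<^esub> f = \<one>\<^bsub>hom_group C A\<^esub>"
      by blast
  qed
qed

lemma comm_group_ndh_cochain_group:
  "comm_group A \<Longrightarrow> comm_group (ndh_cochain_group G A m)"
  unfolding ndh_cochain_group_def by (rule comm_group_hom_group) (simp_all add: ndh_chain_group_eq)

lemma ndh_cochain_hom:
  "f \<in> carrier (ndh_cochain_group G A m) \<Longrightarrow> f \<in> hom (ndh_chain_group G m) A"
  by (simp add: ndh_cochain_group_def hom_group_def)

lemma ndh_coboundary_hom:
  assumes "group G" "comm_group A"
  shows "ndh_coboundary G m \<in> hom (ndh_cochain_group G A m) (ndh_cochain_group G A (m + 1))"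
proof -
  interpret A: comm_group A by fact
  let ?d = "sd_boundary G (m + 1)" and ?C = "ndh_chain_group G m" and ?D = "ndh_chain_group G (m + 1)"
  have d: "?d \<in> hom ?D ?C"
    using sd_boundary_ndh_hom[OF assms(1), of "m + 1"] by simp
  have dc: "?d c \<in> carrier ?C" if "c \<in> carrier ?D" for c
    using hom_in_carrier[OF d that] .
  interpret D: group ?D by (simp add: ndh_chain_group_eq)
  show ?thesis
  proof (rule homI)
    fix f assume f: "f \<in> carrier (ndh_cochain_group G A m)"
    from Group.hom_compose[OF d ndh_cochain_hom[OF f]] have "f \<circ> ?d \<in> hom ?D A" .
    then have "ndh_coboundary G m f \<in> hom ?D A"
      by (rule D.hom_restrict) (simp add: ndh_coboundary_def)
    then show "ndh_coboundary G m f \<in> carrier (ndh_cochain_group G A (m + 1))"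
      by (simp add: ndh_cochain_group_def hom_group_def ndh_coboundary_def)
  next
    fix f g
    show "ndh_coboundary G m (f \<otimes>\<^bsub>ndh_cochain_group G A m\<^esub> g)
      = ndh_coboundary G m f \<otimes>\<^bsub>ndh_cochain_group G A (m + 1)\<^esub> ndh_coboundary G m g"
      using dc by (auto simp: ndh_cochain_group_def hom_group_def ndh_coboundary_def fun_eq_iff)
  qed
qed

section \<open>Integer-valued homomorphisms on the chain groups\<close>

lemma frag_of_in_ndh_chain_group [simp]:
  "frag_of xs \<in> carrier (ndh_chain_group G m) \<longleftrightarrow> xs \<in> ndh_tuples G m"
  by (simp add: ndh_chain_group_eq)

lemma carrier_ndh_chain_group_iff:
  "c \<in> carrier (ndh_chain_group G m) \<longleftrightarrow> Poly_Mapping.keys c \<subseteq> ndh_tuples G m"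
  by (simp add: ndh_chain_group_eq)

lemma hom_ndh_chain_group_zero:
  assumes "f \<in> hom (ndh_chain_group G m) integer_group"
  shows "f 0 = 0"
  using hom_one[OF assms] by (simp add: ndh_chain_group_eq)

lemma hom_ndh_chain_group_diff:
  assumes "f \<in> hom (ndh_chain_group G m) integer_group"
    and "a \<in> carrier (ndh_chain_group G m)" "b \<in> carrier (ndh_chain_group G m)"
  shows "f (a - b) = f a - f b"
proof -
  have "Poly_Mapping.keys (a - b) \<subseteq> ndh_tuples G m"
    using assms(2,3) keys_diff[of a b] by (auto simp: carrier_ndh_chain_group_iff)
  then have "f ((a - b) + b) = f (a - b) + f b"
    using hom_mult[OF assms(1), of "a - b" b] assms(3)
    by (simp add: ndh_chain_group_eq)
  then show ?thesis by simp
qed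

text \<open>Membership and value are proved together: additivity of \<open>f\<close> at each
  inductive step needs the partial sum to lie in the chain group.\<close>

lemma hom_ndh_chain_group_sum_frag_of:
  assumes "f \<in> hom (ndh_chain_group G m) integer_group" "finite I"
    and "\<And>i. i \<in> I \<Longrightarrow> xs i \<in> ndh_tuples G m"
  shows "(\<Sum>i\<in>I. frag_of (xs i)) \<in> carrier (ndh_chain_group G m)
       \<and> f (\<Sum>i\<in>I. frag_of (xs i)) = (\<Sum>i\<in>I. f (frag_of (xs i)))"
  using assms(2,3)
proof (induction I rule: finite_induct)
  case empty
  then show ?case
    using hom_ndh_chain_group_zero[OF assms(1)] by (simp add: carrier_ndh_chain_group_iff)
next
  case (insert i I)
  let ?S = "\<Sum>j\<in>I. frag_of (xs j)"
  have "frag_of (xs i) \<in> carrier (ndh_chain_group G m)" "?S \<in> carrier (ndh_chain_group G m)"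
    using insert by auto
  then have "frag_of (xs i) + ?S \<in> carrier (ndh_chain_group G m)"
    "f (frag_of (xs i) + ?S) = f (frag_of (xs i)) + f ?S"
    using assms(1) keys_add[of "frag_of (xs i)" ?S]
    by (auto simp: hom_def ndh_chain_group_eq)
  then show ?case using insert by simp
qed

lemma hom_ndh_chain_group_eq_zero:
  assumes hom: "f \<in> hom (ndh_chain_group G m) integer_group"
    and gens: "\<And>xs. xs \<in> ndh_tuples G m \<Longrightarrow> f (frag_of xs) = 0"
    and c: "c \<in> carrier (ndh_chain_group G m)"
  shows "f c = 0"
proof -
  have "Poly_Mapping.keys c \<subseteq> ndh_tuples G m"
    using c by (simp add: carrier_ndh_chain_group_iff)
  \<comment> \<open>Membership is carried along because the difference case of
    \<open>frag_induction\<close> supplies only the induction predicate for the two parts, while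
    additivity of \<open>f\<close> needs both in the carrier.\<close>
  then have "c \<in> carrier (ndh_chain_group G m) \<and> f c = 0"
  proof (induction c rule: frag_induction)
    case (diff a b)
    then show ?case
      using hom_ndh_chain_group_diff[OF hom, of a b] keys_diff[of a b]
      by (auto simp: carrier_ndh_chain_group_iff)
  qed (use hom_ndh_chain_group_zero[OF hom] gens in \<open>auto simp: carrier_ndh_chain_group_iff\<close>)
  then show ?thesis ..
qed

section \<open>Tuples, boundaries and cocycles in low degrees\<close>

lemma ndh_tuples_2_iff:
  "xs \<in> ndh_tuples G 2 \<longleftrightarrow>
     (\<exists>x a b. xs = [x, a, b] \<and> {x, a, b} \<subseteq> carrier G \<and> a \<noteq> b)"
  by (auto simp: ndh_tuples_def sd_tuples_def length_Suc_conv numeral_eq_Suc)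

lemma ndh_tuples_3E:
  assumes "xs \<in> ndh_tuples G 3"
  obtains x a b c d where "xs = [x, a, b, c, d]" "{x, a, b, c, d} \<subseteq> carrier G" "a \<noteq> b" "c \<noteq> d"
proof -
  have "length xs = 5" "set xs \<subseteq> carrier G" "xs ! 1 \<noteq> xs ! 2" "xs ! 3 \<noteq> xs ! 4"
    using assms by (auto simp: ndh_tuples_def sd_tuples_def dest: bspec[of _ _ 1] bspec[of _ _ 2])
  then show ?thesis
    by (auto simp: length_Suc_conv numeral_eq_Suc intro: that)
qed

text \<open>The sign for \<open>i = 1\<close> is negative, which puts the acted face first and
  subtracts the omitted one.\<close>

lemma sd_boundary_2:
  "sd_boundary G 2 (frag_of [x, a, b]) = frag_of [heap_op G x a b] - frag_of [x]"
  by (simp add: sd_boundary_def sd_face_omit_def sd_face_act_def)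

lemma sd_boundary_3:
  "sd_boundary G 3 (frag_of [x, a, b, c, d]) =
     frag_of [heap_op G x a b, c, d] - frag_of [x, c, d]
     + (frag_of [x, a, b] - frag_of [heap_op G x c d, heap_op G a c d, heap_op G b c d])"
  by (simp add: sd_boundary_def sd_face_omit_def sd_face_act_def numeral_eq_Suc atLeastAtMostSuc_conv)

lemma sd_boundary_add: "sd_boundary G m (c + c') = sd_boundary G m c + sd_boundary G m c'"
  by (simp add: sd_boundary_def frag_extend_add)

lemma sd_boundary_diff: "sd_boundary G m (c - c') = sd_boundary G m c - sd_boundary G m c'"
  by (simp add: sd_boundary_def frag_extend_diff)

text \<open>Of the eight resulting terms six cancel in pairs. The remaining two agree by right
  self-distributivity of the heap operation: both entries equal
  \<open>x a^-1 b c^-1 d\<close>.\<close>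

lemma sd_boundary_2_3:
  assumes "group G" "xs \<in> ndh_tuples G 3"
  shows "sd_boundary G 2 (sd_boundary G 3 (frag_of xs)) = 0"
proof -
  interpret group G by fact
  obtain x a b c d where xs: "xs = [x, a, b, c, d]" and "{x, a, b, c, d} \<subseteq> carrier G"
    using assms(2) by (rule ndh_tuples_3E)
  then have "heap_op G (heap_op G x c d) (heap_op G a c d) (heap_op G b c d)
      = heap_op G (heap_op G x a b) c d"
    by (simp add: heap_op_def inv_mult_group m_assoc inv_solve_left' flip: m_assoc)
       (simp add: m_assoc inv_solve_left)
  then show ?thesis
    by (simp add: xs sd_boundary_2 sd_boundary_3 sd_boundary_add sd_boundary_diff)
qed

text \<open>The coboundary of \<open>f\<close> is itself a homomorphism, so it is zero once it
  vanishes on the generators \<open>frag_of xs\<close>.\<close>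

lemma mem_kernel_ndh_coboundary_2:
  assumes "group G" and f: "f \<in> carrier (ndh_cochain_group G integer_group 2)"
    and gens: "\<And>xs. xs \<in> ndh_tuples G 3 \<Longrightarrow> f (sd_boundary G 3 (frag_of xs)) = 0"
  shows "f \<in> kernel (ndh_cochain_group G integer_group 2) (ndh_cochain_group G integer_group (2 + 1))
           (ndh_coboundary G 2)"
proof -
  have d: "ndh_coboundary G 2 f \<in> carrier (ndh_cochain_group G integer_group 3)"
    using hom_in_carrier[OF ndh_coboundary_hom[OF assms(1) abelian_integer_group] f] by simp
  then have hom: "ndh_coboundary G 2 f \<in> hom (ndh_chain_group G 3) integer_group"
    by (rule ndh_cochain_hom)
  have "ndh_coboundary G 2 f c = 0" if "c \<in> carrier (ndh_chain_group G 3)" for c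
    by (rule hom_ndh_chain_group_eq_zero[OF hom _ that]) (simp add: ndh_coboundary_def gens)
  then have "ndh_coboundary G 2 f = \<one>\<^bsub>ndh_cochain_group G integer_group 3\<^esub>"
    by (auto simp: ndh_cochain_group_def hom_group_def fun_eq_iff ndh_coboundary_def)
  then show ?thesis using f by (simp add: kernel_def)
qed

text \<open>Dual form of \<open>sd_boundary_2_3\<close>; it places the coboundaries inside the
  cocycles, as the quotient requires.\<close>

lemma ndh_coboundary_1_image_subset_kernel:
  assumes "group G"
  shows "ndh_coboundary G 1 ` carrier (ndh_cochain_group G integer_group 1)
    \<subseteq> kernel (ndh_cochain_group G integer_group 2) (ndh_cochain_group G integer_group (2 + 1))
        (ndh_coboundary G 2)"
proof (rule image_subsetI)
  fix f assume f: "f \<in> carrier (ndh_cochain_group G integer_group 1)"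
  have "ndh_coboundary G 1 f (sd_boundary G 3 (frag_of xs)) = 0" if xs: "xs \<in> ndh_tuples G 3" for xs
  proof -
    have "sd_boundary G 3 (frag_of xs) \<in> carrier (ndh_chain_group G 2)"
      using hom_in_carrier[OF sd_boundary_ndh_hom[OF assms, of 3]] xs by simp
    then have "ndh_coboundary G 1 f (sd_boundary G 3 (frag_of xs))
        = f (sd_boundary G 2 (sd_boundary G 3 (frag_of xs)))"
      by (simp add: ndh_coboundary_def numeral_2_eq_2)
    then show ?thesis
      by (simp only: sd_boundary_2_3[OF assms xs] hom_ndh_chain_group_zero[OF ndh_cochain_hom[OF f]])
  qed
  moreover have "ndh_coboundary G 1 f \<in> carrier (ndh_cochain_group G integer_group 2)"
    using hom_in_carrier[OF ndh_coboundary_hom[OF assms abelian_integer_group] f]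
    by (simp add: numeral_2_eq_2)
  ultimately show "ndh_coboundary G 1 f \<in> kernel (ndh_cochain_group G integer_group 2)
      (ndh_cochain_group G integer_group (2 + 1)) (ndh_coboundary G 2)"
    by (intro mem_kernel_ndh_coboundary_2[OF assms])
qed

section \<open>Cochains prescribed on tuples\<close>

text \<open>This is the linear extension of \<open>u\<close>. Since \<open>frag_extend\<close> takes
  values in free abelian groups, integers are encoded as multiples of the single generator
  \<open>()\<close> and read off by \<open>lookup\<close>; the restriction makes the result
  extensional.\<close>

definition int_cochain :: "('a, 'b) monoid_scheme \<Rightarrow> nat \<Rightarrow> ('a list \<Rightarrow> int) \<Rightarrow> ('a list \<Rightarrow>\<^sub>0 int) \<Rightarrow> int" where
  "int_cochain G m u = (\<lambda>c\<in>carrier (ndh_chain_group G m).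
     Poly_Mapping.lookup (frag_extend (\<lambda>xs. frag_cmul (u xs) (frag_of ())) c) ())"

lemma int_cochain_in_carrier: "int_cochain G m u \<in> carrier (ndh_cochain_group G integer_group m)"
proof -
  have "int_cochain G m u \<in> hom (ndh_chain_group G m) integer_group"
  proof (rule homI)
    fix c c' assume c: "c \<in> carrier (ndh_chain_group G m)" "c' \<in> carrier (ndh_chain_group G m)"
    then have "c + c' \<in> carrier (ndh_chain_group G m)"
      using keys_add[of c c'] by (auto simp: ndh_chain_group_eq free_Abelian_group_def)
    then show "int_cochain G m u (c \<otimes>\<^bsub>ndh_chain_group G m\<^esub> c')
      = int_cochain G m u c \<otimes>\<^bsub>integer_group\<^esub> int_cochain G m u c'"
      using c by (simp add: int_cochain_def ndh_chain_group_eq free_Abelian_group_def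
          frag_extend_add lookup_add)
  qed simp
  then show ?thesis
    by (simp add: ndh_cochain_group_def hom_group_def int_cochain_def)
qed

lemma int_cochain_frag_of [simp]:
  "xs \<in> ndh_tuples G m \<Longrightarrow> int_cochain G m u (frag_of xs) = u xs"
  by (simp add: int_cochain_def)

text \<open>The four faces of \<open>[x, a, b, c, d]\<close> cancel in pairs: the two for
  \<open>i = 1\<close> differ only in the first entry, which the cochain ignores, and the two for
  \<open>i = 2\<close> differ by a right translation, which preserves \<open>a b^-1\<close>.\<close>

lemma right_invariant_cocycle:
  assumes "group G"
  shows "int_cochain G 2 (\<lambda>xs. u (xs ! 1 \<otimes>\<^bsub>G\<^esub> inv\<^bsub>G\<^esub> (xs ! 2)))
    \<in> kernel (ndh_cochain_group G integer_group 2) (ndh_cochain_group G integer_group (2 + 1))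
        (ndh_coboundary G 2)"
    (is "?f \<in> _")
proof (rule mem_kernel_ndh_coboundary_2[OF assms int_cochain_in_carrier])
  interpret group G by fact
  have diff: "?f (c - c') = ?f c - ?f c'"
    if "c \<in> carrier (ndh_chain_group G 2)" "c' \<in> carrier (ndh_chain_group G 2)" for c c'
    by (rule hom_ndh_chain_group_diff[OF ndh_cochain_hom[OF int_cochain_in_carrier] that])
  fix xs assume "xs \<in> ndh_tuples G 3"
  then obtain x a b c d where xs: "xs = [x, a, b, c, d]"
    and G: "x \<in> carrier G" "a \<in> carrier G" "b \<in> carrier G" "c \<in> carrier G" "d \<in> carrier G"
    and ne: "a \<noteq> b" "c \<noteq> d"
    by (auto elim!: ndh_tuples_3E)
  let ?h = "\<lambda>y. heap_op G y c d"
  have h: "?h y \<in> carrier G" if "y \<in> carrier G" for y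
    using that G by (simp add: heap_op_def)
  \<comment> \<open>Right translation is injective, so the translated triple stays nondegenerate and
    the cochain takes its prescribed value there.\<close>
  have "?h a \<noteq> ?h b"
    using G ne by (simp add: heap_op_def)
  then have mem: "[heap_op G x a b, c, d] \<in> ndh_tuples G 2" "[x, c, d] \<in> ndh_tuples G 2"
    "[x, a, b] \<in> ndh_tuples G 2" "[?h x, ?h a, ?h b] \<in> ndh_tuples G 2"
    using G ne h by (auto simp: ndh_tuples_2_iff heap_op_def)
  \<comment> \<open>\<open>?h\<close> is right translation by \<open>c^-1 d\<close>, the element to
    be used as \<open>w\<close> below.\<close>
  have "?h y = y \<otimes>\<^bsub>G\<^esub> (inv\<^bsub>G\<^esub> c \<otimes>\<^bsub>G\<^esub> d)" if "y \<in> carrier G" for y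
    using that G by (simp add: heap_op_def m_assoc)
  moreover have "(a \<otimes>\<^bsub>G\<^esub> w) \<otimes>\<^bsub>G\<^esub> inv\<^bsub>G\<^esub> (b \<otimes>\<^bsub>G\<^esub> w) = a \<otimes>\<^bsub>G\<^esub> inv\<^bsub>G\<^esub> b"
    if "w \<in> carrier G" for w
    using that G by (simp add: inv_mult_group inv_solve_right m_assoc)
  ultimately have invariant: "?h a \<otimes>\<^bsub>G\<^esub> inv\<^bsub>G\<^esub> ?h b = a \<otimes>\<^bsub>G\<^esub> inv\<^bsub>G\<^esub> b"
    using G by simp
  have diff_mem: "frag_of v - frag_of w \<in> carrier (ndh_chain_group G 2)"
    if "v \<in> ndh_tuples G 2" "w \<in> ndh_tuples G 2" for v w
    using that keys_diff[of "frag_of v" "frag_of w"] by (auto simp: carrier_ndh_chain_group_iff)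
  \<comment> \<open>Regrouped as nested differences, so that \<open>diff\<close> alone evaluates
    \<open>?f\<close>.\<close>
  have "sd_boundary G 3 (frag_of xs) =
    (frag_of [heap_op G x a b, c, d] - frag_of [x, c, d]) -
    (frag_of [?h x, ?h a, ?h b] - frag_of [x, a, b])"
    by (simp add: xs sd_boundary_3)
  then have "?f (sd_boundary G 3 (frag_of xs)) =
    (?f (frag_of [heap_op G x a b, c, d]) - ?f (frag_of [x, c, d])) -
    (?f (frag_of [?h x, ?h a, ?h b]) - ?f (frag_of [x, a, b]))"
    using mem by (simp only: diff diff_mem frag_of_in_ndh_chain_group)
  then show "?f (sd_boundary G 3 (frag_of xs)) = 0"
    using mem invariant by simp
qed

section \<open>The second cohomology of a finite group heap\<close>

text \<open>Stated for every finite group, so that both families of the theorem are instances.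
  Finiteness makes the sum over the whole group a chain.\<close>

lemma abelian_rank_ndh_cohomology_2:
  assumes "group G" "finite (carrier G)"
  shows "enat (order G - 1) \<le> abelian_rank (ndh_cohomology_group G integer_group 2)"
proof -
  interpret group G by fact
  let ?C = "ndh_cochain_group G integer_group" and ?d = "ndh_coboundary G :: _ \<Rightarrow> _ \<Rightarrow> _ \<Rightarrow> int"
  define Z where "Z = kernel (?C 2) (?C (2 + 1)) (?d 2)"
  define B where "B = ?d 1 ` carrier (?C 1)"
  define K where "K = (?C 2)\<lparr>carrier := Z\<rparr>"
  have H: "ndh_cohomology_group G integer_group 2 = K Mod B"
    by (simp add: ndh_cohomology_group_def K_def Z_def B_def)
  interpret C: comm_group "?C m" for m
    by (intro comm_group_ndh_cochain_group abelian_integer_group)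
  have hom_d: "group_hom (?C m) (?C (m + 1)) (?d m)" for m
    using ndh_coboundary_hom[OF assms(1) abelian_integer_group]
    by (simp add: group_hom_def group_hom_axioms_def C.is_group)
  have Z_sub: "subgroup Z (?C 2)"
    unfolding Z_def by (rule group_hom.subgroup_kernel[OF hom_d])
  have B_sub: "subgroup B (?C 2)"
    unfolding B_def using group_hom.img_is_subgroup[OF hom_d[of 1]] by (simp add: numeral_2_eq_2)
  have "B \<subseteq> Z"
    unfolding B_def Z_def by (rule ndh_coboundary_1_image_subset_kernel[OF assms(1)])
  interpret K: comm_group K
    unfolding K_def using C.subgroup_imp_group[OF Z_sub] subgroup.subset[OF Z_sub]
    by (intro group.group_comm_groupI) (auto intro!: C.m_comm)
  have B_K: "subgroup B K"
    unfolding K_def by (rule C.subgroup_incl[OF B_sub Z_sub \<open>B \<subseteq> Z\<close>])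
  then have B_normal: "B \<lhd> K"
    by (simp add: K.normal_iff_subgroup)
  \<comment> \<open>The unit is left out because \<open>[x, s, \<one>]\<close> has to be
    nondegenerate.\<close>
  define T where "T = carrier G - {\<one>\<^bsub>G\<^esub>}"
  define \<phi> where "\<phi> t = int_cochain G 2 (\<lambda>xs. of_bool (xs ! 1 \<otimes>\<^bsub>G\<^esub> inv\<^bsub>G\<^esub> (xs ! 2) = t))" for t
  define z where "z s = (\<Sum>x\<in>carrier G. frag_of [x, s, \<one>\<^bsub>G\<^esub>])" for s
  have \<phi>_Z: "\<phi> t \<in> carrier K" for t
    using right_invariant_cocycle[OF assms(1), of "\<lambda>r. of_bool (r = t)"]
    by (simp add: K_def Z_def \<phi>_def)
  have tuple_z: "[x, s, \<one>\<^bsub>G\<^esub>] \<in> ndh_tuples G 2" if "s \<in> T" "x \<in> carrier G" for s x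
    using that by (auto simp: T_def ndh_tuples_2_iff)
  \<comment> \<open>The cochain in the instantiation is arbitrary; only the membership half of the
    conclusion is taken.\<close>
  have z_carrier: "z s \<in> carrier (ndh_chain_group G 2)" if "s \<in> T" for s
    using hom_ndh_chain_group_sum_frag_of[OF ndh_cochain_hom[OF int_cochain_in_carrier] assms(2) tuple_z[OF that]]
    by (simp add: z_def)
  have z_cycle: "sd_boundary G 2 (z s) = 0" if s: "s \<in> T" for s
  proof -
    have "sd_boundary G 2 (z s) = (\<Sum>x\<in>carrier G. sd_boundary G 2 (frag_of [x, s, \<one>\<^bsub>G\<^esub>]))"
      unfolding z_def sd_boundary_def using assms(2) by (simp add: frag_extend_sum o_def)
    also have "\<dots> = (\<Sum>x\<in>carrier G. frag_of [x \<otimes>\<^bsub>G\<^esub> inv\<^bsub>G\<^esub> s]) - (\<Sum>x\<in>carrier G. frag_of [x])"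
      using s by (simp add: sd_boundary_2 heap_op_def T_def sum_subtractf)
    also have "(\<Sum>x\<in>carrier G. frag_of [x \<otimes>\<^bsub>G\<^esub> inv\<^bsub>G\<^esub> s]) = (\<Sum>x\<in>carrier G. frag_of [x])"
      using s by (intro sum.reindex_bij_witness[of _ "\<lambda>x. x \<otimes>\<^bsub>G\<^esub> s" "\<lambda>x. x \<otimes>\<^bsub>G\<^esub> inv\<^bsub>G\<^esub> s"])
        (auto simp: T_def m_assoc)
    finally show ?thesis by simp
  qed
  \<comment> \<open>Evaluation at \<open>z s\<close> descends to the quotient: the coboundary of a
    1-cochain \<open>g\<close> takes there the value
    \<open>g (sd_boundary G 2 (z s)) = g 0 = 0\<close>.\<close>
  have "\<exists>\<chi>. \<chi> \<in> hom (K Mod B) integer_group \<and> (\<forall>f\<in>carrier K. \<chi> (B #>\<^bsub>K\<^esub> f) = f (z s))" if s: "s \<in> T" for s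
  proof -
    \<comment> \<open>Products of cochains are pointwise only on the chain group, hence the appeal
      to \<open>z_carrier\<close>.\<close>
    have "(\<lambda>f. f (z s)) \<in> hom K integer_group"
      using z_carrier[OF s]
      by (intro homI) (simp_all add: K_def ndh_cochain_group_def hom_group_def)
    then interpret ev: group_hom K integer_group "\<lambda>f. f (z s)"
      by (simp add: group_hom_def group_hom_axioms_def)
    have "f (z s) = 0" if "f \<in> B" for f
      using that z_carrier[OF s] z_cycle[OF s]
      by (auto simp: B_def ndh_coboundary_def ndh_cochain_group_def hom_group_def
          hom_ndh_chain_group_zero numeral_2_eq_2)
    then have "B \<subseteq> kernel K integer_group (\<lambda>f. f (z s))"
      using subgroup.subset[OF B_K] by (auto simp: kernel_def)
    from ev.FactGroup_universal_kernel[OF B_normal this] show ?thesis by metis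
  qed
  then obtain \<chi> where \<chi>_hom: "\<And>s. s \<in> T \<Longrightarrow> \<chi> s \<in> hom (K Mod B) integer_group"
    and \<chi>: "\<And>s f. s \<in> T \<Longrightarrow> f \<in> carrier K \<Longrightarrow> \<chi> s (B #>\<^bsub>K\<^esub> f) = f (z s)"
    by metis
  have "\<phi> t (z s) = (\<Sum>x\<in>carrier G. \<phi> t (frag_of [x, s, \<one>\<^bsub>G\<^esub>]))" if "s \<in> T" for s t
    using hom_ndh_chain_group_sum_frag_of[OF ndh_cochain_hom[OF int_cochain_in_carrier] assms(2) tuple_z[OF that]]
    by (simp add: z_def \<phi>_def)
  \<comment> \<open>On \<open>[x, s, \<one>]\<close> the cochain compares
    \<open>s \<otimes> inv \<one> = s\<close> with \<open>t\<close>, so all \<open>order G\<close>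
    summands have the same value, 1 or 0.\<close>
  then have "\<phi> t (z s) = of_bool (s = t) * int (order G)" if "s \<in> T" for s t
    using that tuple_z[OF that] by (auto simp: \<phi>_def T_def order_def)
  \<comment> \<open>The diagonal entries of the pairing need only be nonzero, not
    invertible.\<close>
  moreover have "order G > 0"
    using assms(2) by (simp add: order_gt_0_iff_finite)
  ultimately have dual: "\<chi> s (B #>\<^bsub>K\<^esub> \<phi> t) = 0 \<longleftrightarrow> s \<noteq> t" if "s \<in> T" "t \<in> T" for s t
    using that \<chi> \<phi>_Z by simp
  have "enat (card T) \<le> abelian_rank (K Mod B)"
  proof (rule abelian_rank_ge_card_dual_family[where x = "\<lambda>t. B #>\<^bsub>K\<^esub> \<phi> t" and \<chi> = \<chi>])
    show "comm_group (K Mod B)"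
      by (rule K.abelian_FactGroup[OF B_K])
    show "finite T"
      using assms(2) by (simp add: T_def)
    show "B #>\<^bsub>K\<^esub> \<phi> t \<in> carrier (K Mod B)" for t
      using normal.r_coset_hom_Mod[OF B_normal] \<phi>_Z by (rule hom_in_carrier)
  qed (use \<chi>_hom dual in auto)
  moreover have "card T = order G - 1"
    by (simp add: T_def order_def)
  ultimately show ?thesis by (simp add: H)
qed

theorem proposition5p14:
  fixes n :: nat
  assumes "n \<ge> 2"
  shows "abelian_rank (ndh_cohomology_group (integer_mod_group n) integer_group 2) \<ge> enat (n - 1)
       \<and> abelian_rank (ndh_cohomology_group (dihedral_group n) integer_group 2) \<ge> enat (n - 1)"
proof
  \<comment> \<open>The case \<open>n = 0\<close> has to be excluded here:
    \<open>integer_mod_group 0\<close> is the infinite group of integers.\<close>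
  have "order (integer_mod_group n) = n" "finite (carrier (integer_mod_group n))"
    using assms by (simp_all add: order_def carrier_integer_mod_group)
  then show "abelian_rank (ndh_cohomology_group (integer_mod_group n) integer_group 2) \<ge> enat (n - 1)"
    using abelian_rank_ndh_cohomology_2[OF group_integer_mod_group, of n] by simp
  have "group (dihedral_group n)"
    using assms by (intro group_dihedral_group) simp
  moreover have "finite (carrier (dihedral_group n))"
    by (simp add: dihedral_group_def)
  \<comment> \<open>The order \<open>2 * n\<close> yields more than the required
    \<open>n - 1\<close>; the bound is weakened at the end.\<close>
  ultimately have "enat (2 * n - 1) \<le> abelian_rank (ndh_cohomology_group (dihedral_group n) integer_group 2)"
    using abelian_rank_ndh_cohomology_2 by (metis order_dihedral_group)
  then show "abelian_rank (ndh_cohomology_group (dihedral_group n) integer_group 2) \<ge> enat (n - 1)"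
    by (rule order_trans[rotated]) simp
qed

end
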